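(* Let $P$ be a countable partially ordered set that defines a proper MF space. Then $\{N_p: p\in P\}$ is a basis of the topology of $MF(P)$ consisting of clopen sets.
   Context: For a poset $P$, a pre-filter is a nonempty $R\subseteq P$ such that for all $x,y\in R$ there is $z\in R$ with $z\le x$ and $z\le y$. A filter is an upward closed pre-filter. A maximal filter is a filter not strictly contained in any filter. $MF(P)$ is the set of maximal filters on $P$. For $p\in P$ let $N_p=\{m\in MF(P): p\in m\}$; the open sets of $MF(P)$ are the unions of sets $N_p$. $P$ defines a proper MF space if (i) for all $p,q\in P$, $p\le q$ if and only if $N_p\subseteq N_q$; and (ii) whenever $p,q\in P$ are compatible (there is $s\in P$ with $s\le p$ and $s\le q$) there is $r\in P$ with $N_r=N_p\cap N_q$. *)

theory Defs
  imports "HOL-Analysis.Analysis"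
begin

text \<open>A poset is a carrier set \<open>P\<close> with a relation \<open>r\<close> such that
  \<open>partial_order_on P r\<close>; here \<open>(p, q) \<in> r\<close> means \<open>p \<le> q\<close>.\<close>

definition pre_filter_on :: "'a set \<Rightarrow> 'a rel \<Rightarrow> 'a set \<Rightarrow> bool" where
  "pre_filter_on P r R \<longleftrightarrow>
     R \<subseteq> P \<and> R \<noteq> {} \<and> (\<forall>x\<in>R. \<forall>y\<in>R. \<exists>z\<in>R. (z, x) \<in> r \<and> (z, y) \<in> r)"

definition filter_on :: "'a set \<Rightarrow> 'a rel \<Rightarrow> 'a set \<Rightarrow> bool" where
  "filter_on P r F \<longleftrightarrow>
     pre_filter_on P r F \<and> (\<forall>x\<in>F. \<forall>y\<in>P. (x, y) \<in> r \<longrightarrow> y \<in> F)"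

definition maximal_filter_on :: "'a set \<Rightarrow> 'a rel \<Rightarrow> 'a set \<Rightarrow> bool" where
  "maximal_filter_on P r F \<longleftrightarrow> filter_on P r F \<and> \<not> (\<exists>G. filter_on P r G \<and> F \<subset> G)"

definition MF :: "'a set \<Rightarrow> 'a rel \<Rightarrow> 'a set set" where
  "MF P r = {m. maximal_filter_on P r m}"

definition MF_nbhd :: "'a set \<Rightarrow> 'a rel \<Rightarrow> 'a \<Rightarrow> 'a set set" where
  "MF_nbhd P r p = {m \<in> MF P r. p \<in> m}"

definition MF_topology :: "'a set \<Rightarrow> 'a rel \<Rightarrow> 'a set topology" where
  "MF_topology P r = topology (\<lambda>U. \<exists>S\<subseteq>P. U = (\<Union>p\<in>S. MF_nbhd P r p))"

definition compatible_on :: "'a set \<Rightarrow> 'a rel \<Rightarrow> 'a \<Rightarrow> 'a \<Rightarrow> bool" where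
  "compatible_on P r p q \<longleftrightarrow> (\<exists>s\<in>P. (s, p) \<in> r \<and> (s, q) \<in> r)"

definition defines_proper_MF_space :: "'a set \<Rightarrow> 'a rel \<Rightarrow> bool" where
  "defines_proper_MF_space P r \<longleftrightarrow>
     (\<forall>p\<in>P. \<forall>q\<in>P. (p, q) \<in> r \<longleftrightarrow> MF_nbhd P r p \<subseteq> MF_nbhd P r q) \<and>
     (\<forall>p\<in>P. \<forall>q\<in>P. compatible_on P r p q \<longrightarrow>
        (\<exists>s\<in>P. MF_nbhd P r s = MF_nbhd P r p \<inter> MF_nbhd P r q))"

text \<open>The library's \<open>topological_basis\<close> is tied to the topological-space type classes;
  this is the same notion for an abstract topology.\<close>

definition basis_of_topology :: "'b topology \<Rightarrow> 'b set set \<Rightarrow> bool" where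
  "basis_of_topology X \<B> \<longleftrightarrow>
     (\<forall>B\<in>\<B>. openin X B) \<and> (\<forall>U. openin X U \<longrightarrow> (\<exists>\<C>\<subseteq>\<B>. \<Union>\<C> = U))"

definition clopenin :: "'b topology \<Rightarrow> 'b set \<Rightarrow> bool" where
  "clopenin X U \<longleftrightarrow> openin X U \<and> closedin X U"

text \<open>\<open>topology\<close> is only meaningful on a predicate satisfying \<open>istopology\<close>; the next lemmas
  discharge this, and identify the points of the space.\<close>

lemma MF_nbhd_Int:
  assumes "m \<in> MF_nbhd P r p" "m \<in> MF_nbhd P r q" "p \<in> P" "q \<in> P"
  shows "\<exists>z\<in>P. m \<in> MF_nbhd P r z \<and> MF_nbhd P r z \<subseteq> MF_nbhd P r p \<inter> MF_nbhd P r q"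
proof -
  have f: "filter_on P r m" "p \<in> m" "q \<in> m" "m \<in> MF P r"
    using assms by (auto simp: MF_nbhd_def MF_def maximal_filter_on_def)
  then obtain z where z: "z \<in> m" "(z, p) \<in> r" "(z, q) \<in> r" "z \<in> P"
    unfolding filter_on_def pre_filter_on_def by blast
  have "MF_nbhd P r z \<subseteq> MF_nbhd P r p \<inter> MF_nbhd P r q"
    using z assms(3,4)
    by (auto simp: MF_nbhd_def MF_def maximal_filter_on_def filter_on_def)
  then show ?thesis
    using z f by (auto simp: MF_nbhd_def)
qed

lemma MF_open_iff:
  "(\<exists>S\<subseteq>P. U = (\<Union>p\<in>S. MF_nbhd P r p)) \<longleftrightarrow>
   (\<forall>m\<in>U. \<exists>p\<in>P. m \<in> MF_nbhd P r p \<and> MF_nbhd P r p \<subseteq> U)"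
proof
  assume "\<forall>m\<in>U. \<exists>p\<in>P. m \<in> MF_nbhd P r p \<and> MF_nbhd P r p \<subseteq> U"
  then have "U = (\<Union>p\<in>{p\<in>P. MF_nbhd P r p \<subseteq> U}. MF_nbhd P r p)"
    by blast
  then show "\<exists>S\<subseteq>P. U = (\<Union>p\<in>S. MF_nbhd P r p)"
    by (intro exI[of _ "{p\<in>P. MF_nbhd P r p \<subseteq> U}"]) simp
next
  assume "\<exists>S\<subseteq>P. U = (\<Union>p\<in>S. MF_nbhd P r p)"
  then obtain S where "S \<subseteq> P" "U = (\<Union>p\<in>S. MF_nbhd P r p)"
    by (elim exE conjE)
  then show "\<forall>m\<in>U. \<exists>p\<in>P. m \<in> MF_nbhd P r p \<and> MF_nbhd P r p \<subseteq> U"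
    by fast
qed

lemma istopology_MF: "istopology (\<lambda>U. \<exists>S\<subseteq>P. U = (\<Union>p\<in>S. MF_nbhd P r p))"
  unfolding MF_open_iff istopology_def
proof (intro conjI allI impI ballI)
  fix S T m
  assume S: "\<forall>m\<in>S. \<exists>p\<in>P. m \<in> MF_nbhd P r p \<and> MF_nbhd P r p \<subseteq> S"
    and T: "\<forall>m\<in>T. \<exists>p\<in>P. m \<in> MF_nbhd P r p \<and> MF_nbhd P r p \<subseteq> T"
    and "m \<in> S \<inter> T"
  then obtain p q where "p \<in> P" "m \<in> MF_nbhd P r p" "MF_nbhd P r p \<subseteq> S"
    "q \<in> P" "m \<in> MF_nbhd P r q" "MF_nbhd P r q \<subseteq> T"
    by (meson IntD1 IntD2)
  then show "\<exists>p\<in>P. m \<in> MF_nbhd P r p \<and> MF_nbhd P r p \<subseteq> S \<inter> T"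
    using MF_nbhd_Int[of m P r p q] by blast
next
  fix K m
  assume K: "\<forall>S\<in>K. \<forall>m\<in>S. \<exists>p\<in>P. m \<in> MF_nbhd P r p \<and> MF_nbhd P r p \<subseteq> S"
    and "m \<in> \<Union>K"
  then show "\<exists>p\<in>P. m \<in> MF_nbhd P r p \<and> MF_nbhd P r p \<subseteq> \<Union>K"
    by (meson Sup_upper UnionE order_trans)
qed

lemma openin_MF_topology:
  "openin (MF_topology P r) U \<longleftrightarrow> (\<exists>S\<subseteq>P. U = (\<Union>p\<in>S. MF_nbhd P r p))"
  by (simp only: MF_topology_def topology_inverse'[OF istopology_MF])

lemma topspace_MF_topology: "topspace (MF_topology P r) = MF P r"
proof
  show "topspace (MF_topology P r) \<subseteq> MF P r"
    unfolding topspace_def openin_MF_topology by (auto simp: MF_nbhd_def)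
  have "\<exists>p\<in>P. m \<in> MF_nbhd P r p" if "m \<in> MF P r" for m
  proof -
    have "m \<subseteq> P" "m \<noteq> {}"
      using that unfolding MF_def maximal_filter_on_def filter_on_def pre_filter_on_def
      by simp_all
    with that show ?thesis
      unfolding MF_nbhd_def by blast
  qed
  then have "MF P r = (\<Union>p\<in>P. MF_nbhd P r p)"
    unfolding MF_nbhd_def by blast
  then have "openin (MF_topology P r) (MF P r)"
    unfolding openin_MF_topology by blast
  then show "MF P r \<subseteq> topspace (MF_topology P r)"
    by (rule openin_subset)
qed

end

theory Submission
  imports Defs
begin

text \<open>Only closedness of \<open>N\<^sub>p\<close> needs an argument. If a maximal filter \<open>m\<close> omits \<open>p\<close> but each of
  its elements is compatible with \<open>p\<close>, then the elements \<open>y\<close> with \<open>N\<^sub>q \<inter> N\<^sub>p \<subseteq> N\<^sub>y\<close> for some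
  \<open>q \<in> m\<close> form a filter strictly larger than \<open>m\<close>; it is downward directed because condition (ii)
  realises \<open>N\<^sub>q \<inter> N\<^sub>p\<close> as a basic set. So some \<open>q \<in> m\<close> is incompatible with \<open>p\<close>, and \<open>N\<^sub>q\<close> is a
  neighbourhood of \<open>m\<close> disjoint from \<open>N\<^sub>p\<close>.\<close>

text \<open>A filter containing both \<open>p\<close> and \<open>q\<close> is directed, so it would
  contain a common lower bound of them.\<close>

lemma MF_nbhd_disjoint_if_incompatible:
  assumes "\<not> compatible_on P r p q"
  shows "MF_nbhd P r p \<inter> MF_nbhd P r q = {}"
proof (rule equals0I)
  fix m assume "m \<in> MF_nbhd P r p \<inter> MF_nbhd P r q"
  then have "pre_filter_on P r m" "p \<in> m" "q \<in> m"
    by (auto simp: MF_nbhd_def MF_def maximal_filter_on_def filter_on_def)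
  then have "compatible_on P r p q"
    unfolding pre_filter_on_def compatible_on_def by blast
  with assms show False ..
qed

lemma maximal_filter_incompatible:
  assumes proper: "defines_proper_MF_space P r"
    and m: "m \<in> MF P r" and p: "p \<in> P" "p \<notin> m"
  shows "\<exists>q\<in>m. \<not> compatible_on P r q p"
proof (rule ccontr)
  assume "\<not> (\<exists>q\<in>m. \<not> compatible_on P r q p)"
  then have compat: "compatible_on P r q p" if "q \<in> m" for q
    using that by blast
  let ?N = "MF_nbhd P r"
  define F where "F = {y \<in> P. \<exists>q\<in>m. ?N q \<inter> ?N p \<subseteq> ?N y}"
  have le_iff: "(x, y) \<in> r \<longleftrightarrow> ?N x \<subseteq> ?N y" if "x \<in> P" "y \<in> P" for x y
    using proper that unfolding defines_proper_MF_space_def by blast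
  have mP: "m \<subseteq> P" and ne: "m \<noteq> {}"
    and dir: "\<And>x y. x \<in> m \<Longrightarrow> y \<in> m \<Longrightarrow> \<exists>z\<in>m. (z, x) \<in> r \<and> (z, y) \<in> r"
    using m unfolding MF_def maximal_filter_on_def filter_on_def pre_filter_on_def by simp_all
  have max: "\<not> m \<subset> G" if "filter_on P r G" for G
    using m that unfolding MF_def maximal_filter_on_def by blast
  \<comment> \<open>For \<open>y \<in> m\<close> the witness is \<open>y\<close> itself; for
    \<open>p\<close> any element of the nonempty \<open>m\<close> serves.\<close>
  have "m \<subseteq> F" "p \<in> F"
    using mP ne p(1) unfolding F_def by blast+
  have "\<exists>z\<in>F. (z, x) \<in> r \<and> (z, y) \<in> r" if xy: "x \<in> F" "y \<in> F" for x y
  proof -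
    obtain q q' where q: "q \<in> m" "?N q \<inter> ?N p \<subseteq> ?N x" "q' \<in> m" "?N q' \<inter> ?N p \<subseteq> ?N y"
      using xy unfolding F_def by blast
    \<comment> \<open>Directedness of \<open>m\<close> replaces the two witnesses by a single one,
      \<open>z\<close>, whose trace on \<open>?N p\<close> lies in both \<open>?N x\<close> and
      \<open>?N y\<close>.\<close>
    obtain z where z: "z \<in> m" "(z, q) \<in> r" "(z, q') \<in> r"
      using dir q by blast
    obtain s where s: "s \<in> P" "?N s = ?N z \<inter> ?N p"
      using proper compat[OF z(1)] z(1) mP p(1) unfolding defines_proper_MF_space_def by blast
    have "?N z \<subseteq> ?N q" "?N z \<subseteq> ?N q'"
      using le_iff z q mP by blast+
    then have "?N s \<subseteq> ?N x" "?N s \<subseteq> ?N y"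
      using s(2) q by blast+
    \<comment> \<open>Condition (i) turns inclusions of basic sets back into the order.\<close>
    then have "(s, x) \<in> r" "(s, y) \<in> r"
      using le_iff s(1) xy unfolding F_def by blast+
    moreover have "s \<in> F"
      using s z(1) unfolding F_def by blast
    ultimately show ?thesis
      by blast
  qed
  moreover have "y \<in> F" if "x \<in> F" "y \<in> P" "(x, y) \<in> r" for x y
    using that le_iff[of x y] unfolding F_def by blast
  ultimately have "filter_on P r F"
    using \<open>p \<in> F\<close> unfolding filter_on_def pre_filter_on_def F_def by blast
  then show False
    using max \<open>m \<subseteq> F\<close> \<open>p \<in> F\<close> p(2) by blast
qed

lemma openin_MF_nbhd:
  assumes "p \<in> P"
  shows "openin (MF_topology P r) (MF_nbhd P r p)"
  unfolding openin_MF_topology using assms by (intro exI[of _ "{p}"]) simp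

lemma closedin_MF_nbhd:
  assumes "defines_proper_MF_space P r" "p \<in> P"
  shows "closedin (MF_topology P r) (MF_nbhd P r p)"
proof -
  \<comment> \<open>By the pointwise criterion \<open>MF_open_iff\<close>, the complement is open
    once each of its points has a basic neighbourhood inside it.\<close>
  have "\<exists>q\<in>P. m \<in> MF_nbhd P r q \<and> MF_nbhd P r q \<subseteq> MF P r - MF_nbhd P r p"
    if m: "m \<in> MF P r - MF_nbhd P r p" for m
  proof -
    have "m \<in> MF P r" "p \<notin> m"
      using m by (auto simp: MF_nbhd_def)
    then obtain q where q: "q \<in> m" "\<not> compatible_on P r q p"
      using maximal_filter_incompatible assms by metis
    have "q \<in> P"
      using q(1) m by (auto simp: MF_def maximal_filter_on_def filter_on_def pre_filter_on_def)
    moreover have "m \<in> MF_nbhd P r q" "MF_nbhd P r q \<subseteq> MF P r"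
      using q(1) m by (auto simp: MF_nbhd_def)
    ultimately show ?thesis
      using MF_nbhd_disjoint_if_incompatible[OF q(2)] by blast
  qed
  then have "openin (MF_topology P r) (MF P r - MF_nbhd P r p)"
    unfolding openin_MF_topology MF_open_iff by blast
  then show ?thesis
    unfolding closedin_def topspace_MF_topology by (auto simp: MF_nbhd_def)
qed

text \<open>The index set \<open>S\<close> of an open set yields the required subfamily as its image
  under \<open>MF_nbhd P r\<close>.\<close>

lemma basis_of_MF_topology:
  "basis_of_topology (MF_topology P r) {MF_nbhd P r p | p. p \<in> P}"
  unfolding basis_of_topology_def
proof (intro conjI ballI allI impI)
  fix U assume "openin (MF_topology P r) U"
  then obtain S where "S \<subseteq> P" "U = \<Union> (MF_nbhd P r ` S)"
    unfolding openin_MF_topology by blast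
  then show "\<exists>\<C>\<subseteq>{MF_nbhd P r p | p. p \<in> P}. \<Union>\<C> = U"
    by (intro exI[of _ "MF_nbhd P r ` S"]) auto
qed (auto intro: openin_MF_nbhd)

theorem proposition8:
  fixes P :: "'a set" and r :: "'a rel"
  assumes "partial_order_on P r"
    and "countable P"
    and "defines_proper_MF_space P r"
  shows "basis_of_topology (MF_topology P r) {MF_nbhd P r p | p. p \<in> P} \<and>
    (\<forall>B \<in> {MF_nbhd P r p | p. p \<in> P}. clopenin (MF_topology P r) B)"
proof (intro conjI ballI)
  fix B assume "B \<in> {MF_nbhd P r p | p. p \<in> P}"
  then obtain p where "p \<in> P" "B = MF_nbhd P r p"
    by blast
  then show "clopenin (MF_topology P r) B"
    using openin_MF_nbhd closedin_MF_nbhd[OF assms(3)] by (simp add: clopenin_def)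
qed (rule basis_of_MF_topology)

end
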